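(* For each time step $t$, assume that the sequence $\mathbf{u}^f_t$ used to initialize the Jacobi DMPC algorithm (described in the context) is feasible for the centralized MPC problem with initial state $x_t$. Let $\bar p_t\ge 1$ be the last iteration number at time $t$, and let $V_t=V(\mathbf{u}_{(\bar p_t),t},x_t)$ be the cost of the final combined solution at time $t$. Then along the closed-loop trajectory $x_{t+1}=Ax_t+Bu_t$, where $u_t$ is the first input of $\mathbf{u}_{(\bar p_t),t}$, one has, for every $t$, $$V_{t+1}\le V_t-x_t^TQx_t-u_t^TRu_t .$$ More precisely, writing $\Phi_{(p)}=V(\mathbf{u}_{(p),t+1},x_{t+1})$ for the cost of the combined solution at iteration $p$ of time step $t+1$, $$V_{t+1}=\Phi_{(\bar p_{t+1})}\le\cdots\le\Phi_{(p+1)}\le\Phi_{(p)}\le\cdots\le\Phi_{(1)}\le V_t-x_t^TQx_t-u_t^TRu_t .$$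
   Context: Plant: there are $M$ subsystems with states $x^i\in\mathbb{R}^{n_i}$, inputs $u^i\in\mathbb{R}^{m_i}$ and dynamics $x^i_{t+1}=\sum_{j=1}^M(A_{ij}x^j_t+B_{ij}u^j_t)$. With $x=(x^1,\dots,x^M)$, $u=(u^1,\dots,u^M)$, $A=(A_{ij})$, $B=(B_{ij})$, this reads $x_{t+1}=Ax_t+Bu_t$; the pair $(A,B)$ is stabilizable. Neighborhoods: $\mathcal{N}^i\subseteq\{1,\dots,M\}$ denotes the set consisting of $i$ and all indices of subsystems having a direct dynamical coupling or a direct constraint coupling with subsystem $i$; thus $i\in\mathcal{N}^i$, and $j\in\mathcal{N}^i\Leftrightarrow i\in\mathcal{N}^j$. For a vector $w=(w^1,\dots,w^M)$, $w^{+i}$ denotes the collection of components $w^j$ with $j\in\mathcal{N}^i$, and $w^{\bar i}$ the collection of components with $j\notin\mathcal{N}^i$. Constraints: for each $i$ there are convex coupled constraints $x^{+i}\in\mathcal{X}^{+i}(x^{\bar i})$, $u^{+i}\in\mathcal{U}^{+i}(u^{\bar i})$, with closed convex sets parameterized by the components outside $\mathcal{N}^i$. The sets $\mathcal{X}$ and $\mathcal{U}$ are the closed convex sets of all full vectors $x$, respectively $u$, satisfying these constraints for all $i=1,\dots,M$. Cost: $N\ge1$ is the prediction horizon, $Q=\mathrm{diag}(Q_1,\dots,Q_M)$ and $R=\mathrm{diag}(R_1,\dots,R_M)$ are block diagonal with $Q_i$ (symmetric) positive semidefinite and $R_i$ (symmetric) positive definite. For an input sequence $\mathbf{u}=(u_0,\dots,u_{N-1})$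 and initial state $x_0$, let $x_{k+1}=Ax_k+Bu_k$ (predicted states) and $V(\mathbf{u},x_0)=\sum_{k=0}^{N-1}\left(x_k^TQx_k+u_k^TRu_k\right)$. Centralized MPC problem with initial state $x_0$: minimize $V(\mathbf{u},x_0)$ over $\mathbf{u}$ subject to $u_k\in\mathcal{U}$ for $k=0,\dots,N-1$, $x_k\in\mathcal{X}$ for $k=1,\dots,N$, and $x_N=0$. Local problem of subsystem $i$ with initial state $x_0$, given an assumed feasible sequence $\hat{\mathbf{u}}$: minimize $V(\mathbf{u},x_0)$ subject to all constraints of the centralized problem and $\mathbf{u}^{\bar i}=\hat{\mathbf{u}}^{\bar i}$, where $\mathbf{u}^j=(u^j_0,\dots,u^j_{N-1})$; that is, only the inputs of the subsystems in $\mathcal{N}^i$ are optimized. Jacobi DMPC algorithm, with fixed weights $\lambda^i\in(0,1)$, $\sum_{i=1}^M\lambda^i=1$: at each time $t$, measure $x_t$ and set $\mathbf{u}_{(0),t}=\mathbf{u}^f_t$. For $p=1,\dots,\bar p_t$, let $\mathbf{u}^{s|i}_{(p),t}$ be the (full) minimizer of the local problem of subsystem $i$ with initial state $x_t$ and assumed sequence $\mathbf{u}_{(p-1),t}$, and set $\mathbf{u}_{(p),t}=\sum_{i=1}^M\lambda^i\mathbf{u}^{s|i}_{(p),t}$. The number of iterations $\bar p_t\ge1$ is determined by a stopping rule (a tolerance on $\|\mathbf{u}_{(p),t}-\mathbf{u}_{(p-1),t}\|$ or a maximal number $p_{max}$ of iterations). Writing $\mathbf{u}_{(\bar p_t),t}=(u_{0,(\bar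 p_t)},\dots,u_{N-1,(\bar p_t)})$, apply $u_t=u_{0,(\bar p_t)}$ to the plant, and initialize the next time step by the shifted sequence $\mathbf{u}^f_{t+1}=(u_{1,(\bar p_t)},\dots,u_{N-1,(\bar p_t)},0)$. At the first time step $\mathbf{u}^f_t$ is a given sequence. *)

theory Defs
  imports "HOL-Analysis.Analysis"
begin

text \<open>
  Full vectors live in \<open>real ^ 'n\<close> (states) and \<open>real ^ 'm\<close> (inputs). A map \<open>own\<close> from coordinates
  to the finite type \<open>'s\<close> of subsystems tells which subsystem a coordinate belongs to, so the
  number \<open>n\<^sub>i\<close> is \<open>card {a. own a = i}\<close> and may differ between subsystems. Subvectors and matrix
  blocks are represented inside the full space, padded with zeros.
\<close>

definition subvec :: "('n \<Rightarrow> 's) \<Rightarrow> 's set \<Rightarrow> real ^ 'n \<Rightarrow> real ^ 'n" where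
  "subvec own J x = (\<chi> a. if own a \<in> J then x $ a else 0)"

definition block ::
  "('r \<Rightarrow> 's) \<Rightarrow> ('c \<Rightarrow> 's) \<Rightarrow> 's \<Rightarrow> 's \<Rightarrow> real ^ 'c ^ 'r \<Rightarrow> real ^ 'c ^ 'r" where
  "block rown cown i j M = (\<chi> a b. if rown a = i \<and> cown b = j then M $ a $ b else 0)"

definition block_diagonal :: "('n \<Rightarrow> 's) \<Rightarrow> real ^ 'n ^ 'n \<Rightarrow> bool" where
  "block_diagonal own M \<longleftrightarrow> (\<forall>i j. i \<noteq> j \<longrightarrow> block own own i j M = 0)"

definition block_sym_pos_semidef :: "('n \<Rightarrow> 's) \<Rightarrow> 's \<Rightarrow> real ^ 'n ^ 'n \<Rightarrow> bool" where
  "block_sym_pos_semidef own i M \<longleftrightarrow>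
     transpose (block own own i i M) = block own own i i M \<and>
     (\<forall>v. 0 \<le> subvec own {i} v \<bullet> (block own own i i M *v subvec own {i} v))"

definition block_sym_pos_def :: "('n \<Rightarrow> 's) \<Rightarrow> 's \<Rightarrow> real ^ 'n ^ 'n \<Rightarrow> bool" where
  "block_sym_pos_def own i M \<longleftrightarrow>
     transpose (block own own i i M) = block own own i i M \<and>
     (\<forall>v. subvec own {i} v \<noteq> 0 \<longrightarrow>
        0 < subvec own {i} v \<bullet> (block own own i i M *v subvec own {i} v))"

text \<open>Discrete-time stabilizability: some state feedback makes all complex eigenvalues of the
  closed loop lie in the open unit disc.\<close>

definition complex_matrix :: "real ^ 'n ^ 'm \<Rightarrow> complex ^ 'n ^ 'm" where
  "complex_matrix M = (\<chi> a b. complex_of_real (M $ a $ b))"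

definition schur_stable :: "real ^ 'n ^ 'n \<Rightarrow> bool" where
  "schur_stable M \<longleftrightarrow>
     (\<forall>z v. v \<noteq> 0 \<and> complex_matrix M *v v = z *s v \<longrightarrow> cmod z < 1)"

definition stabilizable :: "real ^ 'n ^ 'n \<Rightarrow> real ^ 'm ^ 'n \<Rightarrow> bool" where
  "stabilizable A B \<longleftrightarrow> (\<exists>K :: real ^ 'n ^ 'm. schur_stable (A + B ** K))"

definition dynamically_coupled ::
  "('n \<Rightarrow> 's) \<Rightarrow> ('m \<Rightarrow> 's) \<Rightarrow> real ^ 'n ^ 'n \<Rightarrow> real ^ 'm ^ 'n \<Rightarrow> 's \<Rightarrow> 's \<Rightarrow> bool" where
  "dynamically_coupled xown uown A B i j \<longleftrightarrow>
     block xown xown i j A \<noteq> 0 \<or> block xown uown i j B \<noteq> 0 \<or>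
     block xown xown j i A \<noteq> 0 \<or> block xown uown j i B \<noteq> 0"

text \<open>The relation \<open>C\<close> is the direct constraint coupling between subsystems, a datum of the problem.\<close>

definition neighborhood ::
  "('n \<Rightarrow> 's) \<Rightarrow> ('m \<Rightarrow> 's) \<Rightarrow> real ^ 'n ^ 'n \<Rightarrow> real ^ 'm ^ 'n \<Rightarrow> ('s \<Rightarrow> 's \<Rightarrow> bool) \<Rightarrow> 's \<Rightarrow> 's set" where
  "neighborhood xown uown A B C i =
     {i} \<union> {j. dynamically_coupled xown uown A B i j} \<union> {j. C i j}"

text \<open>Here \<open>S i z\<close> is the constraint set of subsystem \<open>i\<close> for the components with index in \<open>Nb i\<close>,
  given the components \<open>z\<close> with index outside \<open>Nb i\<close>.\<close>

definition closed_convex_coupling ::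
  "('n \<Rightarrow> 's) \<Rightarrow> ('s \<Rightarrow> 's set) \<Rightarrow> ('s \<Rightarrow> real ^ 'n \<Rightarrow> (real ^ 'n) set) \<Rightarrow> bool" where
  "closed_convex_coupling own Nb S \<longleftrightarrow>
     (\<forall>i w. closed (S i (subvec own (- Nb i) w)) \<and> convex (S i (subvec own (- Nb i) w)) \<and>
        S i (subvec own (- Nb i) w) \<subseteq> range (subvec own (Nb i)))"

definition constraint_set ::
  "('n \<Rightarrow> 's) \<Rightarrow> ('s \<Rightarrow> 's set) \<Rightarrow> ('s \<Rightarrow> real ^ 'n \<Rightarrow> (real ^ 'n) set) \<Rightarrow> (real ^ 'n) set" where
  "constraint_set own Nb S = {w. \<forall>i. subvec own (Nb i) w \<in> S i (subvec own (- Nb i) w)}"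

text \<open>An input sequence of length \<open>N\<close> is a function on \<open>nat\<close> of which only the values at \<open>k < N\<close>
  are ever used.\<close>

primrec predicted_state ::
  "real ^ 'n ^ 'n \<Rightarrow> real ^ 'm ^ 'n \<Rightarrow> (nat \<Rightarrow> real ^ 'm) \<Rightarrow> real ^ 'n \<Rightarrow> nat \<Rightarrow> real ^ 'n" where
  "predicted_state A B u x0 0 = x0"
| "predicted_state A B u x0 (Suc k) = A *v predicted_state A B u x0 k + B *v u k"

definition mpc_cost ::
  "real ^ 'n ^ 'n \<Rightarrow> real ^ 'm ^ 'n \<Rightarrow> real ^ 'n ^ 'n \<Rightarrow> real ^ 'm ^ 'm \<Rightarrow> nat \<Rightarrow>
   (nat \<Rightarrow> real ^ 'm) \<Rightarrow> real ^ 'n \<Rightarrow> real" where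
  "mpc_cost A B Q R N u x0 =
     (\<Sum>k<N. predicted_state A B u x0 k \<bullet> (Q *v predicted_state A B u x0 k) + u k \<bullet> (R *v u k))"

definition mpc_feasible ::
  "real ^ 'n ^ 'n \<Rightarrow> real ^ 'm ^ 'n \<Rightarrow> (real ^ 'n) set \<Rightarrow> (real ^ 'm) set \<Rightarrow> nat \<Rightarrow>
   real ^ 'n \<Rightarrow> (nat \<Rightarrow> real ^ 'm) \<Rightarrow> bool" where
  "mpc_feasible A B X U N x0 u \<longleftrightarrow>
     (\<forall>k<N. u k \<in> U) \<and> (\<forall>k\<in>{1..N}. predicted_state A B u x0 k \<in> X) \<and>
     predicted_state A B u x0 N = 0"

definition local_feasible ::
  "real ^ 'n ^ 'n \<Rightarrow> real ^ 'm ^ 'n \<Rightarrow> (real ^ 'n) set \<Rightarrow> (real ^ 'm) set \<Rightarrow> nat \<Rightarrow>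
   ('m \<Rightarrow> 's) \<Rightarrow> 's set \<Rightarrow> real ^ 'n \<Rightarrow> (nat \<Rightarrow> real ^ 'm) \<Rightarrow> (nat \<Rightarrow> real ^ 'm) \<Rightarrow> bool" where
  "local_feasible A B X U N uown Ni x0 uhat u \<longleftrightarrow>
     mpc_feasible A B X U N x0 u \<and>
     (\<forall>k<N. subvec uown (- Ni) (u k) = subvec uown (- Ni) (uhat k))"

definition local_minimizer ::
  "real ^ 'n ^ 'n \<Rightarrow> real ^ 'm ^ 'n \<Rightarrow> real ^ 'n ^ 'n \<Rightarrow> real ^ 'm ^ 'm \<Rightarrow>
   (real ^ 'n) set \<Rightarrow> (real ^ 'm) set \<Rightarrow> nat \<Rightarrow> ('m \<Rightarrow> 's) \<Rightarrow> 's set \<Rightarrow>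
   real ^ 'n \<Rightarrow> (nat \<Rightarrow> real ^ 'm) \<Rightarrow> (nat \<Rightarrow> real ^ 'm) \<Rightarrow> bool" where
  "local_minimizer A B Q R X U N uown Ni x0 uhat u \<longleftrightarrow>
     is_arg_min (\<lambda>v. mpc_cost A B Q R N v x0) (local_feasible A B X U N uown Ni x0 uhat) u"

definition shifted :: "nat \<Rightarrow> (nat \<Rightarrow> real ^ 'm) \<Rightarrow> nat \<Rightarrow> real ^ 'm" where
  "shifted N u k = (if Suc k < N then u (Suc k) else 0)"

text \<open>
  A run of the Jacobi scheme in closed loop: \<open>x t\<close> is the plant state, \<open>uf t\<close> the initializing
  sequence, \<open>us t p i\<close> the minimizer of the local problem of subsystem \<open>i\<close> in iteration \<open>p\<close>,
  \<open>uc t p\<close> the combined sequence after iteration \<open>p\<close>, and \<open>pbar t\<close> the last iteration number.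
  Any stopping rule that performs at least one iteration is admitted.
\<close>

definition jacobi_dmpc_run ::
  "real ^ 'n ^ 'n \<Rightarrow> real ^ 'm ^ 'n \<Rightarrow> real ^ 'n ^ 'n \<Rightarrow> real ^ 'm ^ 'm \<Rightarrow>
   (real ^ 'n) set \<Rightarrow> (real ^ 'm) set \<Rightarrow> nat \<Rightarrow> ('m \<Rightarrow> 's::finite) \<Rightarrow> ('s \<Rightarrow> 's set) \<Rightarrow> ('s \<Rightarrow> real) \<Rightarrow>
   (nat \<Rightarrow> nat) \<Rightarrow> (nat \<Rightarrow> real ^ 'n) \<Rightarrow> (nat \<Rightarrow> nat \<Rightarrow> real ^ 'm) \<Rightarrow>
   (nat \<Rightarrow> nat \<Rightarrow> 's \<Rightarrow> nat \<Rightarrow> real ^ 'm) \<Rightarrow> (nat \<Rightarrow> nat \<Rightarrow> nat \<Rightarrow> real ^ 'm) \<Rightarrow> bool" where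
  "jacobi_dmpc_run A B Q R X U N uown Nb lam pbar x uf us uc \<longleftrightarrow>
     (\<forall>t. pbar t \<ge> 1 \<and>
        uc t 0 = uf t \<and>
        (\<forall>p\<in>{1..pbar t}.
           (\<forall>i. local_minimizer A B Q R X U N uown (Nb i) (x t) (uc t (p - 1)) (us t p i)) \<and>
           uc t p = (\<lambda>k. \<Sum>i\<in>UNIV. lam i *\<^sub>R us t p i k)) \<and>
        x (Suc t) = A *v x t + B *v uc t (pbar t) 0 \<and>
        uf (Suc t) = shifted N (uc t (pbar t)))"

end

theory Submission
  imports Defs
begin

text \<open>
  The predicted states depend affinely on the input sequence, so the cost, a sum of positive
  semidefinite quadratic forms in the predicted states and inputs, is convex, and so is the set of
  feasible sequences.

  Within one time step, a feasible sequence \<open>w\<close> is admissible for each local problem that assumes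
  \<open>w\<close>, because it agrees with itself outside the neighborhood. Hence each local minimizer costs at
  most as much as \<open>w\<close>, and by convexity so does the weighted mean of the minimizers
  (\<open>jacobi_step_cost\<close>), which is again feasible and can play the role of \<open>w\<close> in the next iteration.

  Between time steps, the shifted sequence follows the old prediction from its second state on, then
  rests at the origin, where the terminal constraint has brought it. Its cost is therefore the old
  cost without the first stage cost (\<open>mpc_cost_shifted\<close>). The first iteration of the next time step
  starts from this sequence, which links the two chains of inequalities.
\<close>

section \<open>Convexity of positive semidefinite quadratic forms\<close>

lemma block_diagonal_quadratic_form:
  fixes M :: "real ^ 'n::finite ^ 'n" and own :: "'n \<Rightarrow> 's::finite"
  assumes "block_diagonal own M"
  shows "v \<bullet> (M *v v) =
    (\<Sum>i\<in>UNIV. subvec own {i} v \<bullet> (block own own i i M *v subvec own {i} v))"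
proof -
  have off_diagonal: "M $ a $ b = 0" if "own a \<noteq> own b" for a b
  proof -
    have "block own own (own a) (own b) M $ a $ b = 0"
      using assms that by (simp add: block_diagonal_def)
    then show ?thesis by (simp add: block_def)
  qed
  have "(\<Sum>i\<in>UNIV. subvec own {i} v \<bullet> (block own own i i M *v subvec own {i} v))
      = (\<Sum>i\<in>UNIV. \<Sum>a\<in>UNIV. \<Sum>b\<in>UNIV.
           if own a = i then if own b = i then v $ a * (M $ a $ b * v $ b) else 0 else 0)"
    by (auto simp: subvec_def block_def inner_vec_def matrix_vector_mult_def sum_distrib_left
        intro!: sum.cong)
  also have "\<dots> = (\<Sum>a\<in>UNIV. \<Sum>b\<in>UNIV. \<Sum>i\<in>UNIV.
           if own a = i then if own b = i then v $ a * (M $ a $ b * v $ b) else 0 else 0)"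
    by (subst sum.swap) (intro sum.cong refl sum.swap)
  also have "\<dots> = (\<Sum>a\<in>UNIV. \<Sum>b\<in>UNIV. v $ a * (M $ a $ b * v $ b))"
    using off_diagonal by (auto intro!: sum.cong)
  also have "\<dots> = v \<bullet> (M *v v)"
    by (simp add: inner_vec_def matrix_vector_mult_def sum_distrib_left)
  finally show ?thesis by simp
qed

lemma block_diagonal_pos_semidef:
  fixes M :: "real ^ 'n::finite ^ 'n" and own :: "'n \<Rightarrow> 's::finite"
  assumes "block_diagonal own M" "\<And>i. block_sym_pos_semidef own i M"
  shows "0 \<le> v \<bullet> (M *v v)"
  using assms(2)
  by (auto simp: block_diagonal_quadratic_form[OF assms(1)] block_sym_pos_semidef_def
      intro!: sum_nonneg)

lemma block_sym_pos_def_imp_semidef: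
  assumes "block_sym_pos_def own i M"
  shows "block_sym_pos_semidef own i M"
  unfolding block_sym_pos_semidef_def
proof (intro conjI allI)
  show "transpose (block own own i i M) = block own own i i M"
    using assms by (simp add: block_sym_pos_def_def)
  show "0 \<le> subvec own {i} v \<bullet> (block own own i i M *v subvec own {i} v)" for v
    using assms by (cases "subvec own {i} v = 0") (auto simp: block_sym_pos_def_def less_imp_le)
qed

text \<open>The gap between the two sides is the weighted mean of the form at the deviations from the
  mean.\<close>

lemma quadratic_form_weighted_mean_le:
  fixes M :: "real ^ 'n::finite ^ 'n" and v :: "'s::finite \<Rightarrow> real ^ 'n"
  assumes psd: "\<And>w. 0 \<le> w \<bullet> (M *v w)"
    and lam: "\<And>i. 0 \<le> lam i" "(\<Sum>i\<in>UNIV. lam i) = 1"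
  shows "(\<Sum>i\<in>UNIV. lam i *\<^sub>R v i) \<bullet> (M *v (\<Sum>i\<in>UNIV. lam i *\<^sub>R v i))
    \<le> (\<Sum>i\<in>UNIV. lam i * (v i \<bullet> (M *v v i)))"
proof -
  define m where "m = (\<Sum>i\<in>UNIV. lam i *\<^sub>R v i)"
  have left: "(\<Sum>i\<in>UNIV. lam i * (v i \<bullet> (M *v m))) = m \<bullet> (M *v m)"
    by (simp add: m_def inner_sum_left)
  have Mm: "M *v m = (\<Sum>i\<in>UNIV. lam i *\<^sub>R (M *v v i))"
    by (simp add: m_def linear_sum[OF matrix_vector_mul_linear] scaleR_matrix_vector_assoc[symmetric]
        matrix_vector_mult_scaleR)
  have right: "(\<Sum>i\<in>UNIV. lam i * (m \<bullet> (M *v v i))) = m \<bullet> (M *v m)"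
    by (simp add: Mm inner_sum_right)
  have "0 \<le> (\<Sum>i\<in>UNIV. lam i * ((v i - m) \<bullet> (M *v (v i - m))))"
    by (intro sum_nonneg mult_nonneg_nonneg lam psd)
  also have "\<dots> = (\<Sum>i\<in>UNIV. lam i * (v i \<bullet> (M *v v i)) - lam i * (v i \<bullet> (M *v m))
                   - lam i * (m \<bullet> (M *v v i)) + lam i * (m \<bullet> (M *v m)))"
    by (intro sum.cong refl)
      (simp add: matrix_vector_mult_diff_distrib inner_diff_left inner_diff_right algebra_simps)
  also have "\<dots> = (\<Sum>i\<in>UNIV. lam i * (v i \<bullet> (M *v v i))) - m \<bullet> (M *v m)"
    by (simp add: sum.distrib sum_subtractf left right sum_distrib_right[symmetric] lam)
  finally show ?thesis by (simp add: m_def)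
qed

section \<open>Convexity of the predictive control problem\<close>

lemma predicted_state_weighted_mean:
  fixes w :: "'s::finite \<Rightarrow> nat \<Rightarrow> real ^ 'm::finite" and A :: "real ^ 'n::finite ^ 'n"
  assumes "(\<Sum>i\<in>UNIV. lam i) = 1"
  shows "predicted_state A B (\<lambda>k. \<Sum>i\<in>UNIV. lam i *\<^sub>R w i k) x0 k
    = (\<Sum>i\<in>UNIV. lam i *\<^sub>R predicted_state A B (w i) x0 k)"
proof (induction k)
  case 0
  show ?case using assms by (simp add: scaleR_sum_left[symmetric])
next
  case (Suc k)
  show ?case
    by (simp add: Suc linear_sum[OF matrix_vector_mul_linear] matrix_vector_mult_scaleR
        scaleR_add_right sum.distrib)
qed

lemma mpc_cost_weighted_mean_le:
  fixes w :: "'s::finite \<Rightarrow> nat \<Rightarrow> real ^ 'm::finite" and A :: "real ^ 'n::finite ^ 'n"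
  assumes "\<And>v. 0 \<le> v \<bullet> (Q *v v)" "\<And>v. 0 \<le> v \<bullet> (R *v v)"
    and lam: "\<And>i. 0 \<le> lam i" "(\<Sum>i\<in>UNIV. lam i) = 1"
  shows "mpc_cost A B Q R N (\<lambda>k. \<Sum>i\<in>UNIV. lam i *\<^sub>R w i k) x0
    \<le> (\<Sum>i\<in>UNIV. lam i * mpc_cost A B Q R N (w i) x0)"
proof -
  have "mpc_cost A B Q R N (\<lambda>k. \<Sum>i\<in>UNIV. lam i *\<^sub>R w i k) x0
    \<le> (\<Sum>k<N. (\<Sum>i\<in>UNIV. lam i *
              (predicted_state A B (w i) x0 k \<bullet> (Q *v predicted_state A B (w i) x0 k)))
            + (\<Sum>i\<in>UNIV. lam i * (w i k \<bullet> (R *v w i k))))"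
    unfolding mpc_cost_def predicted_state_weighted_mean[OF lam(2)]
    by (intro sum_mono add_mono quadratic_form_weighted_mean_le assms)
  also have "\<dots> = (\<Sum>i\<in>UNIV. lam i * mpc_cost A B Q R N (w i) x0)"
    unfolding mpc_cost_def sum_distrib_left
    by (simp add: sum.swap[of _ UNIV "{..<N}"] sum.distrib distrib_left)
  finally show ?thesis .
qed

lemma mpc_feasible_weighted_mean:
  fixes w :: "'s::finite \<Rightarrow> nat \<Rightarrow> real ^ 'm::finite" and A :: "real ^ 'n::finite ^ 'n"
  assumes "convex X" "convex U"
    and lam: "\<And>i. 0 \<le> lam i" "(\<Sum>i\<in>UNIV. lam i) = 1"
    and "\<And>i. mpc_feasible A B X U N x0 (w i)"
  shows "mpc_feasible A B X U N x0 (\<lambda>k. \<Sum>i\<in>UNIV. lam i *\<^sub>R w i k)"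
  using assms unfolding mpc_feasible_def predicted_state_weighted_mean[OF lam(2)]
  by (auto intro!: convex_sum)

section \<open>Cost decrease along the iterations and along the closed loop\<close>

lemma local_minimizer_feasible:
  assumes "local_minimizer A B Q R X U N uown J x0 w v"
  shows "mpc_feasible A B X U N x0 v"
  using assms by (simp add: local_minimizer_def is_arg_min_def local_feasible_def)

lemma local_minimizer_cost_le:
  assumes "local_minimizer A B Q R X U N uown J x0 w v" "mpc_feasible A B X U N x0 w"
  shows "mpc_cost A B Q R N v x0 \<le> mpc_cost A B Q R N w x0"
proof -
  have "local_feasible A B X U N uown J x0 w w"
    using assms(2) by (simp add: local_feasible_def)
  then show ?thesis
    using assms(1) by (auto simp: local_minimizer_def is_arg_min_def not_less)
qed

text \<open>By convexity the mean costs at most the weighted mean of the minimal local costs, none of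
  which exceeds the cost of \<open>w\<close>, a competitor in every local problem.\<close>

lemma jacobi_step_cost:
  fixes v :: "'s::finite \<Rightarrow> nat \<Rightarrow> real ^ 'm::finite" and A :: "real ^ 'n::finite ^ 'n"
  assumes psd: "\<And>v. 0 \<le> v \<bullet> (Q *v v)" "\<And>v. 0 \<le> v \<bullet> (R *v v)"
    and lam: "\<And>i. 0 \<le> lam i" "(\<Sum>i\<in>UNIV. lam i) = 1"
    and min: "\<And>i. local_minimizer A B Q R X U N uown (J i) x0 w (v i)"
    and w: "mpc_feasible A B X U N x0 w"
  shows "mpc_cost A B Q R N (\<lambda>k. \<Sum>i\<in>UNIV. lam i *\<^sub>R v i k) x0 \<le> mpc_cost A B Q R N w x0"
proof -
  have "mpc_cost A B Q R N (\<lambda>k. \<Sum>i\<in>UNIV. lam i *\<^sub>R v i k) x0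
    \<le> (\<Sum>i\<in>UNIV. lam i * mpc_cost A B Q R N (v i) x0)"
    by (rule mpc_cost_weighted_mean_le[OF psd lam])
  also have "\<dots> \<le> (\<Sum>i\<in>UNIV. lam i * mpc_cost A B Q R N w x0)"
    by (intro sum_mono mult_left_mono local_minimizer_cost_le[OF min w] lam)
  also have "\<dots> = mpc_cost A B Q R N w x0"
    by (simp add: sum_distrib_right[symmetric] lam)
  finally show ?thesis .
qed

lemma predicted_state_shifted:
  assumes "k < N"
  shows "predicted_state A B (shifted N w) (A *v x0 + B *v w 0) k = predicted_state A B w x0 (Suc k)"
  using assms by (induction k) (auto simp: shifted_def)

text \<open>The stage appended at the end of the horizon is free: there the old prediction is at its
  terminal state, the origin, and the input is zero.\<close>

lemma mpc_cost_shifted: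
  assumes "N \<ge> 1" "predicted_state A B w x0 N = 0"
  shows "mpc_cost A B Q R N (shifted N w) (A *v x0 + B *v w 0)
    = mpc_cost A B Q R N w x0 - x0 \<bullet> (Q *v x0) - w 0 \<bullet> (R *v w 0)"
proof -
  obtain n where n: "N = Suc n" using assms(1) by (cases N) auto
  let ?P = "predicted_state A B w x0"
  have "mpc_cost A B Q R N (shifted N w) (A *v x0 + B *v w 0)
    = (\<Sum>k<N. ?P (Suc k) \<bullet> (Q *v ?P (Suc k)) + shifted N w k \<bullet> (R *v shifted N w k))"
    unfolding mpc_cost_def by (intro sum.cong refl) (simp only: predicted_state_shifted lessThan_iff)
  also have "\<dots> = (\<Sum>k<n. ?P (Suc k) \<bullet> (Q *v ?P (Suc k)) + w (Suc k) \<bullet> (R *v w (Suc k)))"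
    using assms(2)[unfolded n] unfolding n
    by (simp add: shifted_def del: predicted_state.simps)
  also have "\<dots> = mpc_cost A B Q R N w x0 - x0 \<bullet> (Q *v x0) - w 0 \<bullet> (R *v w 0)"
    unfolding mpc_cost_def n sum.lessThan_Suc_shift by simp
  finally show ?thesis .
qed

theorem mainTheorem2:
  fixes xown :: "'n::finite \<Rightarrow> 's::finite" and uown :: "'m::finite \<Rightarrow> 's"
    and A :: "real ^ 'n ^ 'n" and B :: "real ^ 'm ^ 'n"
    and C :: "'s \<Rightarrow> 's \<Rightarrow> bool" and Nb :: "'s \<Rightarrow> 's set"
    and Xp :: "'s \<Rightarrow> real ^ 'n \<Rightarrow> (real ^ 'n) set" and Up :: "'s \<Rightarrow> real ^ 'm \<Rightarrow> (real ^ 'm) set"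
    and X :: "(real ^ 'n) set" and U :: "(real ^ 'm) set"
    and Q :: "real ^ 'n ^ 'n" and R :: "real ^ 'm ^ 'm" and N :: nat
    and lam :: "'s \<Rightarrow> real" and pbar :: "nat \<Rightarrow> nat"
    and x :: "nat \<Rightarrow> real ^ 'n" and uf :: "nat \<Rightarrow> nat \<Rightarrow> real ^ 'm"
    and us :: "nat \<Rightarrow> nat \<Rightarrow> 's \<Rightarrow> nat \<Rightarrow> real ^ 'm" and uc :: "nat \<Rightarrow> nat \<Rightarrow> nat \<Rightarrow> real ^ 'm"
    and u :: "nat \<Rightarrow> real ^ 'm" and V :: "nat \<Rightarrow> real" and \<Phi> :: "nat \<Rightarrow> nat \<Rightarrow> real"
  assumes stab: "stabilizable A B"
    and C_sym: "symp C"
    and Nb_eq: "Nb = neighborhood xown uown A B C"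
    and Xp: "closed_convex_coupling xown Nb Xp"
    and Up: "closed_convex_coupling uown Nb Up"
    and X_eq: "X = constraint_set xown Nb Xp" and X: "closed X" "convex X"
    and U_eq: "U = constraint_set uown Nb Up" and U: "closed U" "convex U"
    and N: "N \<ge> 1"
    and Q: "block_diagonal xown Q" "\<And>i. block_sym_pos_semidef xown i Q"
    and R: "block_diagonal uown R" "\<And>i. block_sym_pos_def uown i R"
    and lam: "\<And>i. 0 < lam i \<and> lam i < 1" "(\<Sum>i\<in>UNIV. lam i) = 1"
    and run: "jacobi_dmpc_run A B Q R X U N uown Nb lam pbar x uf us uc"
    and feas: "\<And>t. mpc_feasible A B X U N (x t) (uf t)"
    and u_eq: "\<And>t. u t = uc t (pbar t) 0"
    and V_eq: "\<And>t. V t = mpc_cost A B Q R N (uc t (pbar t)) (x t)"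
    and \<Phi>_eq: "\<And>t p. \<Phi> t p = mpc_cost A B Q R N (uc (Suc t) p) (x (Suc t))"
  shows "\<forall>t. V (Suc t) \<le> V t - x t \<bullet> (Q *v x t) - u t \<bullet> (R *v u t) \<and>
             V (Suc t) = \<Phi> t (pbar (Suc t)) \<and>
             (\<forall>p. 1 \<le> p \<and> p < pbar (Suc t) \<longrightarrow> \<Phi> t (Suc p) \<le> \<Phi> t p) \<and>
             \<Phi> t 1 \<le> V t - x t \<bullet> (Q *v x t) - u t \<bullet> (R *v u t)"
proof -
  have psd: "0 \<le> v \<bullet> (Q *v v)" "0 \<le> w \<bullet> (R *v w)" for v w
    using block_diagonal_pos_semidef[OF Q]
      block_diagonal_pos_semidef[OF R(1) block_sym_pos_def_imp_semidef[OF R(2)]] by auto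
  have lam_nonneg: "0 \<le> lam i" for i
    using lam(1) less_imp_le by blast
  have start: "uc t 0 = uf t" and pbar: "1 \<le> pbar t"
    and plant: "x (Suc t) = A *v x t + B *v uc t (pbar t) 0"
    and shift: "uf (Suc t) = shifted N (uc t (pbar t))" for t
    using run by (auto simp: jacobi_dmpc_run_def)
  have min: "local_minimizer A B Q R X U N uown (Nb i) (x t) (uc t p) (us t (Suc p) i)"
    and mean: "uc t (Suc p) = (\<lambda>k. \<Sum>i\<in>UNIV. lam i *\<^sub>R us t (Suc p) i k)"
    if "p < pbar t" for t p i
  proof -
    have "Suc p \<in> {1..pbar t}" using that by simp
    then show "local_minimizer A B Q R X U N uown (Nb i) (x t) (uc t p) (us t (Suc p) i)"
      and "uc t (Suc p) = (\<lambda>k. \<Sum>i\<in>UNIV. lam i *\<^sub>R us t (Suc p) i k)"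
      using run unfolding jacobi_dmpc_run_def by (metis diff_Suc_1)+
  qed
  have feasible: "mpc_feasible A B X U N (x t) (uc t p)" if "p \<le> pbar t" for t p
    using that
  proof (induction p)
    case 0
    show ?case using feas by (simp add: start)
  next
    case (Suc p)
    then show ?case
      by (simp add: mean mpc_feasible_weighted_mean X U lam(2) lam_nonneg
          local_minimizer_feasible[OF min])
  qed
  have step: "mpc_cost A B Q R N (uc t (Suc p)) (x t) \<le> mpc_cost A B Q R N (uc t p) (x t)"
    if "p < pbar t" for t p
    unfolding mean[OF that]
    by (rule jacobi_step_cost[OF psd lam_nonneg lam(2) min[OF that] feasible[OF less_imp_le[OF that]]])
  have V_last: "V (Suc t) = \<Phi> t (pbar (Suc t))" for t
    by (simp add: V_eq \<Phi>_eq)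
  have \<Phi>_step: "\<Phi> t (Suc p) \<le> \<Phi> t p" if "p < pbar (Suc t)" for t p
    unfolding \<Phi>_eq by (rule step[OF that])
  have \<Phi>_0: "\<Phi> t 0 = V t - x t \<bullet> (Q *v x t) - u t \<bullet> (R *v u t)" for t
  proof -
    have "predicted_state A B (uc t (pbar t)) (x t) N = 0"
      using feasible[of "pbar t" t] by (simp add: mpc_feasible_def)
    from mpc_cost_shifted[OF N this] show ?thesis
      by (simp add: \<Phi>_eq V_eq u_eq start shift plant)
  qed
  have \<Phi>_1: "\<Phi> t 1 \<le> V t - x t \<bullet> (Q *v x t) - u t \<bullet> (R *v u t)" for t
    using \<Phi>_step[of 0 t] pbar[of "Suc t"] by (simp add: \<Phi>_0)
  have \<Phi>_le_1: "p \<le> pbar (Suc t) \<longrightarrow> \<Phi> t p \<le> \<Phi> t 1" if "1 \<le> p" for t p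
    using that
  proof (induction p rule: dec_induct)
    case base
    show ?case by simp
  next
    case (step p)
    then show ?case using \<Phi>_step[of p t] by auto
  qed
  have "V (Suc t) \<le> V t - x t \<bullet> (Q *v x t) - u t \<bullet> (R *v u t)" for t
    using \<Phi>_le_1[OF pbar, of "Suc t" t] \<Phi>_1[of t] by (simp add: V_last)
  then show ?thesis
    using V_last \<Phi>_step \<Phi>_1 by blast
qed

end
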